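(* Let $(K,v_0)$ be a valued field with $K$ algebraically closed and let $x$ be transcendental over $K$. Then every extension $(K(x)|K,v)$ of $v_0$ to $K(x)$ is pure (in $x$).
   Context: Valuations are Krull valuations written additively; $vK$ is the value group, $Kv$ the residue field, $tv$ the residue of $t$. For an extension $(K(x)|K,v)$, let $\mathrm{appr}_v(x,K)_\gamma=\{c\in K\mid v(x-c)\ge\gamma\}$ for $\gamma\in vK$, and let $S$ be the set of all $\gamma\in vK$ with $\mathrm{appr}_v(x,K)_\gamma\neq\emptyset$ (the support of the approximation type $\mathrm{appr}_v(x,K)$). The approximation type $\mathrm{appr}_v(x,K)$ is immediate if $S\ne\emptyset$ and the intersection of all nonempty sets of the form $\{c\in K\mid v(x-c)\ge\gamma\}$ or $\{c\in K\mid v(x-c)>\gamma\}$ ($\gamma\in vK$) is empty. It is transcendental immediate if in addition for every polynomial $f\in K[X]$ there is $\delta\in S$ such that $vf(c)$ is constant for $c\in\mathrm{appr}_v(x,K)_\delta$. An element $t\in K(x)$ is value-transcendental if $vt$ is not a torsion element modulo $v_0K$; residue-transcendental if $vt=0$ and $tv$ is transcendental over $Kv_0$; valuation-transcendental if it is one of the two. The extension $(K(x)|K,v)$ is pure (in $x$) if either $d(x-b)$ is valuation-transcendental for some $b,d\in K$, or $\mathrm{appr}_v(x,K)$ is a transcendental immediate approximation type. *)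

theory Defs
  imports "HOL-Algebra.Algebraic_Closure" "HOL-Algebra.Generated_Fields" "HOL-Library.Extended"
begin

section \<open>Krull valuations\<close>

text \<open>Valuations are written additively, with values in an arbitrary (not necessarily archimedean)
  linearly ordered abelian group, extended by \<open>\<infinity>\<close> as the value of zero. The type
  of extended elements also contains \<open>-\<infinity>\<close>, which is excluded as a value.\<close>

definition krull_valuation ::
  "('a, 'b) ring_scheme \<Rightarrow> ('a \<Rightarrow> 'g::linordered_ab_group_add extended) \<Rightarrow> bool" where
  "krull_valuation F v \<longleftrightarrow>
     (\<forall>a\<in>carrier F. v a \<noteq> -\<infinity>) \<and>
     (\<forall>a\<in>carrier F. v a = \<infinity> \<longleftrightarrow> a = \<zero>\<^bsub>F\<^esub>) \<and>
     (\<forall>a\<in>carrier F. \<forall>b\<in>carrier F. v (a \<otimes>\<^bsub>F\<^esub> b) = v a + v b) \<and>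
     (\<forall>a\<in>carrier F. \<forall>b\<in>carrier F. min (v a) (v b) \<le> v (a \<oplus>\<^bsub>F\<^esub> b))"

text \<open>The value group \<open>vK\<close>; zero contributes nothing, as its value is not of the form \<open>Fin \<gamma>\<close>.\<close>

definition value_group ::
  "('a \<Rightarrow> 'g::linordered_ab_group_add extended) \<Rightarrow> 'a set \<Rightarrow> 'g set" where
  "value_group v K = {\<gamma>. \<exists>a\<in>K. v a = Fin \<gamma>}"

definition valuation_ring ::
  "('a, 'b) ring_scheme \<Rightarrow> ('a \<Rightarrow> 'g::linordered_ab_group_add extended) \<Rightarrow> ('a, 'b) ring_scheme"
  where "valuation_ring F v = F\<lparr>carrier := {a \<in> carrier F. 0 \<le> v a}\<rparr>"

definition valuation_ideal ::
  "('a, 'b) ring_scheme \<Rightarrow> ('a \<Rightarrow> 'g::linordered_ab_group_add extended) \<Rightarrow> 'a set" where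
  "valuation_ideal F v = {a \<in> carrier F. 0 < v a}"

definition residue_field ::
  "('a, 'b) ring_scheme \<Rightarrow> ('a \<Rightarrow> 'g::linordered_ab_group_add extended) \<Rightarrow> 'a set ring" where
  "residue_field F v = valuation_ring F v Quot valuation_ideal F v"

definition residue ::
  "('a, 'b) ring_scheme \<Rightarrow> ('a \<Rightarrow> 'g::linordered_ab_group_add extended) \<Rightarrow> 'a \<Rightarrow> 'a set" where
  "residue F v t = valuation_ideal F v +>\<^bsub>valuation_ring F v\<^esub> t"

text \<open>The residue field \<open>Kv\<close> of a subfield \<open>K\<close>, as canonically embedded in the residue field of \<open>F\<close>.\<close>

definition sub_residue_field ::
  "('a, 'b) ring_scheme \<Rightarrow> ('a \<Rightarrow> 'g::linordered_ab_group_add extended) \<Rightarrow> 'a set \<Rightarrow> 'a set set"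
  where "sub_residue_field F v K = residue F v ` {a \<in> K. 0 \<le> v a}"


section \<open>Approximation types\<close>

text \<open>Throughout, \<open>F\<close> is the field \<open>K(x)\<close>.\<close>

definition appr ::
  "('a, 'b) ring_scheme \<Rightarrow> 'a set \<Rightarrow> ('a \<Rightarrow> 'g::linordered_ab_group_add extended) \<Rightarrow> 'a \<Rightarrow> 'g \<Rightarrow> 'a set"
  where "appr F K v x \<gamma> = {c \<in> K. Fin \<gamma> \<le> v (x \<ominus>\<^bsub>F\<^esub> c)}"

definition appr_open ::
  "('a, 'b) ring_scheme \<Rightarrow> 'a set \<Rightarrow> ('a \<Rightarrow> 'g::linordered_ab_group_add extended) \<Rightarrow> 'a \<Rightarrow> 'g \<Rightarrow> 'a set"
  where "appr_open F K v x \<gamma> = {c \<in> K. Fin \<gamma> < v (x \<ominus>\<^bsub>F\<^esub> c)}"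

definition appr_support ::
  "('a, 'b) ring_scheme \<Rightarrow> 'a set \<Rightarrow> ('a \<Rightarrow> 'g::linordered_ab_group_add extended) \<Rightarrow> 'a \<Rightarrow> 'g set"
  where "appr_support F K v x = {\<gamma> \<in> value_group v K. appr F K v x \<gamma> \<noteq> {}}"

definition appr_balls ::
  "('a, 'b) ring_scheme \<Rightarrow> 'a set \<Rightarrow> ('a \<Rightarrow> 'g::linordered_ab_group_add extended) \<Rightarrow> 'a \<Rightarrow> 'a set set"
  where "appr_balls F K v x =
    {B. B \<noteq> {} \<and> (\<exists>\<gamma>\<in>value_group v K. B = appr F K v x \<gamma> \<or> B = appr_open F K v x \<gamma>)}"

definition immediate_appr ::
  "('a, 'b) ring_scheme \<Rightarrow> 'a set \<Rightarrow> ('a \<Rightarrow> 'g::linordered_ab_group_add extended) \<Rightarrow> 'a \<Rightarrow> bool"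
  where "immediate_appr F K v x \<longleftrightarrow>
    appr_support F K v x \<noteq> {} \<and> \<Inter>(appr_balls F K v x) = {}"

definition transcendental_immediate_appr ::
  "('a, 'b) ring_scheme \<Rightarrow> 'a set \<Rightarrow> ('a \<Rightarrow> 'g::linordered_ab_group_add extended) \<Rightarrow> 'a \<Rightarrow> bool"
  where "transcendental_immediate_appr F K v x \<longleftrightarrow>
    immediate_appr F K v x \<and>
    (\<forall>f\<in>carrier (univ_poly F K). \<exists>\<delta>\<in>appr_support F K v x.
       \<forall>c\<in>appr F K v x \<delta>. \<forall>c'\<in>appr F K v x \<delta>. v (ring.eval F f c) = v (ring.eval F f c'))"


section \<open>Valuation-transcendental elements and pure extensions\<close>

text \<open>The sum is the \<open>n\<close>-fold multiple of \<open>\<gamma>\<close>.\<close>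

definition torsion_modulo :: "'g::linordered_ab_group_add set \<Rightarrow> 'g \<Rightarrow> bool" where
  "torsion_modulo H \<gamma> \<longleftrightarrow> (\<exists>n::nat. n > 0 \<and> (\<Sum>i<n. \<gamma>) \<in> H)"

definition value_transcendental ::
  "'a set \<Rightarrow> ('a \<Rightarrow> 'g::linordered_ab_group_add extended) \<Rightarrow> 'a \<Rightarrow> bool" where
  "value_transcendental K v t \<longleftrightarrow> (\<exists>\<gamma>. v t = Fin \<gamma> \<and> \<not> torsion_modulo (value_group v K) \<gamma>)"

definition residue_transcendental ::
  "('a, 'b) ring_scheme \<Rightarrow> 'a set \<Rightarrow> ('a \<Rightarrow> 'g::linordered_ab_group_add extended) \<Rightarrow> 'a \<Rightarrow> bool"
  where "residue_transcendental F K v t \<longleftrightarrow>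
    v t = 0 \<and>
    ring.transcendental (residue_field F v) (sub_residue_field F v K) (residue F v t)"

definition valuation_transcendental ::
  "('a, 'b) ring_scheme \<Rightarrow> 'a set \<Rightarrow> ('a \<Rightarrow> 'g::linordered_ab_group_add extended) \<Rightarrow> 'a \<Rightarrow> bool"
  where "valuation_transcendental F K v t \<longleftrightarrow>
    value_transcendental K v t \<or> residue_transcendental F K v t"

definition pure_extension ::
  "('a, 'b) ring_scheme \<Rightarrow> 'a set \<Rightarrow> ('a \<Rightarrow> 'g::linordered_ab_group_add extended) \<Rightarrow> 'a \<Rightarrow> bool"
  where "pure_extension F K v x \<longleftrightarrow>
    (\<exists>b\<in>K. \<exists>d\<in>K. valuation_transcendental F K v (d \<otimes>\<^bsub>F\<^esub> (x \<ominus>\<^bsub>F\<^esub> b))) \<or>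
    transcendental_immediate_appr F K v x"

end

theory Submission
  imports Defs
begin

text \<open>The proof looks at how well \<open>x\<close> can be approximated from \<open>K\<close>, that is, at the set of values
  \<open>v (x - c)\<close> with \<open>c \<in> K\<close>. These are finite because \<open>x \<notin> K\<close>. There are three possibilities.

  Some \<open>v (x - b)\<close> lies outside \<open>vK\<close>. An algebraically closed field contains \<open>n\<close>-th roots, and ordered
  groups are torsion free, so \<open>vK\<close> contains every element that is torsion modulo it
  (\<open>value_group_pure\<close>). Hence \<open>x - b\<close> is value-transcendental.

  All these values lie in \<open>vK\<close> and some \<open>v (x - b)\<close> is the largest. Scale by \<open>d \<in> K\<close> so that
  \<open>t = d (x - b)\<close> has value \<open>0\<close>. Maximality says that \<open>v (t - c) \<le> 0\<close> for all \<open>c \<in> K\<close>. A polynomial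
  relation for the residue of \<open>t\<close> would lift to a polynomial \<open>p\<close> over \<open>K\<close> whose leading coefficient is
  a unit of the valuation ring and for which \<open>v (p t) > 0\<close>. But \<open>p\<close> is a product of linear factors, each
  of which has value at most \<open>0\<close> at \<open>t\<close> (\<open>residue_transcendental_if_no_closer\<close>). So \<open>t\<close> is
  residue-transcendental.

  All these values lie in \<open>vK\<close> and none is the largest. Then no element of \<open>K\<close> can lie in all the balls
  around \<open>x\<close>. Moreover, an element \<open>c\<close> of \<open>K\<close> that is closer to \<open>x\<close> than every root \<open>r\<close> of a polynomial
  \<open>p\<close> satisfies \<open>v (c - r) = v (x - r)\<close>, so \<open>v (p c)\<close> does not depend on \<open>c\<close>
  (\<open>transcendental_immediate_if_no_closest\<close>). So the approximation type is transcendental immediate.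

  Algebraic closedness thus enters through roots of elements and through the formula
  \<open>v (p y) = v (lead_coeff p) + (\<Sum>c\<leftarrow>cs. v (y - c))\<close> of \<open>v_eval_eq_sum\<close>, which serves both of the
  last two cases.\<close>

section \<open>Krull valuations on fields\<close>

locale valued_field = field F for F (structure) +
  fixes v :: "'a \<Rightarrow> 'g::linordered_ab_group_add extended"
  assumes krull: "krull_valuation F v"
begin

lemma v_eq_infty_iff: "a \<in> carrier F \<Longrightarrow> v a = \<infinity> \<longleftrightarrow> a = \<zero>"
  and v_mult: "a \<in> carrier F \<Longrightarrow> b \<in> carrier F \<Longrightarrow> v (a \<otimes> b) = v a + v b"
  and v_add_ge: "a \<in> carrier F \<Longrightarrow> b \<in> carrier F \<Longrightarrow> min (v a) (v b) \<le> v (a \<oplus> b)"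
  using krull unfolding krull_valuation_def by auto

lemma v_zero: "v \<zero> = \<infinity>"
  using v_eq_infty_iff by simp

lemma v_finite:
  assumes "a \<in> carrier F" "a \<noteq> \<zero>"
  obtains \<gamma> where "v a = Fin \<gamma>"
proof (cases "v a")
  case Minf
  then show ?thesis using krull assms(1) unfolding krull_valuation_def by auto
qed (use assms v_eq_infty_iff that in auto)

lemma v_one: "v \<one> = 0"
proof -
  obtain \<gamma> where g: "v \<one> = Fin \<gamma>" by (rule v_finite) auto
  have "v \<one> = v \<one> + v \<one>" using v_mult[of \<one> \<one>] by simp
  then show ?thesis using g by (simp add: zero_extended_def)
qed

text \<open>Since \<open>(-1)\<^sup>2 = 1\<close>, the value of \<open>-1\<close> is a \<open>2\<close>-torsion element, and ordered groups have none
  except \<open>0\<close>.\<close>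

lemma v_uminus:
  assumes "a \<in> carrier F"
  shows "v (\<ominus> a) = v a"
proof -
  obtain \<gamma> where g: "v (\<ominus> \<one>) = Fin \<gamma>" by (rule v_finite[of "\<ominus> \<one>"]) auto
  have "(\<ominus> \<one>) \<otimes> (\<ominus> \<one>) = \<one>" by (simp add: l_minus r_minus)
  then have "v (\<ominus> \<one>) + v (\<ominus> \<one>) = 0" using v_mult[of "\<ominus> \<one>" "\<ominus> \<one>"] v_one by simp
  then have "\<gamma> = 0" using g by (simp add: zero_extended_def)
  moreover have "\<ominus> a = (\<ominus> \<one>) \<otimes> a" using assms by (simp add: l_minus)
  ultimately show ?thesis using v_mult[of "\<ominus> \<one>" a] g assms by (simp flip: zero_extended_def)
qed

lemma v_diff_ge:
  assumes "a \<in> carrier F" "b \<in> carrier F"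
  shows "min (v a) (v b) \<le> v (a \<ominus> b)"
  using v_add_ge[of a "\<ominus> b"] assms by (simp add: v_uminus minus_eq)

text \<open>The sharp form of the ultrametric inequality: if the value of \<open>a - b\<close> were larger than \<open>v a\<close>, then
  \<open>a = (a - b) + b\<close> would be a sum of two elements of value larger than \<open>v a\<close>.\<close>

lemma v_diff_eq_min:
  assumes "a \<in> carrier F" "b \<in> carrier F" "v a < v b"
  shows "v (a \<ominus> b) = v a"
proof (rule antisym)
  have "(a \<ominus> b) \<oplus> b = a" using assms by algebra
  then have "min (v (a \<ominus> b)) (v b) \<le> v a" using v_add_ge[of "a \<ominus> b" b] assms by simp
  then show "v (a \<ominus> b) \<le> v a" using assms(3) by (auto simp: min_def split: if_splits)
  show "v a \<le> v (a \<ominus> b)" using v_diff_ge[OF assms(1,2)] assms(3) by (simp add: min_absorb1 less_imp_le)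
qed

lemma v_pow:
  assumes "a \<in> carrier F" "v a = Fin \<gamma>"
  shows "v (a [^] (n::nat)) = Fin (\<Sum>i<n. \<gamma>)"
  by (induction n) (use assms in \<open>auto simp: v_mult v_one zero_extended_def add.commute\<close>)

lemma v_foldr_mult:
  assumes "\<And>c. c \<in> set cs \<Longrightarrow> g c \<in> carrier F" "a \<in> carrier F"
  shows "v (foldr (\<lambda>c z. g c \<otimes> z) cs a) = v a + (\<Sum>c\<leftarrow>cs. v (g c))"
proof -
  have "foldr (\<lambda>c z. g c \<otimes> z) cs a \<in> carrier F \<and> ?thesis"
    using assms by (induction cs) (auto simp: v_mult ac_simps)
  then show ?thesis ..
qed


section \<open>The residue field\<close>

lemma valuation_ring_subring: "subring {a \<in> carrier F. 0 \<le> v a} F"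
proof (rule subringI)
  fix a b assume ab: "a \<in> {a \<in> carrier F. 0 \<le> v a}" "b \<in> {a \<in> carrier F. 0 \<le> v a}"
  show "a \<otimes> b \<in> {a \<in> carrier F. 0 \<le> v a}" using ab add_mono[of 0 "v a" 0 "v b"] by (auto simp: v_mult)
  show "a \<oplus> b \<in> {a \<in> carrier F. 0 \<le> v a}" using ab order_trans[OF _ v_add_ge[of a b], of 0] by simp
qed (auto simp: v_one v_uminus)

lemma valuation_ring_cring: "cring (valuation_ring F v)"
  using subcringI'[OF valuation_ring_subring] subcring_iff[of "{a \<in> carrier F. 0 \<le> v a}"]
  unfolding valuation_ring_def by auto

text \<open>A product of two elements of value \<open>0\<close> has value \<open>0\<close>. Primality is what makes the residue field an
  integral domain, so that algebraicity over a subring can be tested by a single nonzero polynomial.\<close>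

lemma valuation_ideal_prime: "primeideal (valuation_ideal F v) (valuation_ring F v)"
proof -
  interpret O: cring "valuation_ring F v" by (rule valuation_ring_cring)
  have carr: "carrier (valuation_ring F v) = {a \<in> carrier F. 0 \<le> v a}"
    and mult: "a \<otimes>\<^bsub>valuation_ring F v\<^esub> b = a \<otimes> b"
    and add: "a \<oplus>\<^bsub>valuation_ring F v\<^esub> b = a \<oplus> b"
    and zero: "\<zero>\<^bsub>valuation_ring F v\<^esub> = \<zero>" for a b
    unfolding valuation_ring_def by auto
  have uminus: "\<ominus>\<^bsub>valuation_ring F v\<^esub> a = \<ominus> a" if "a \<in> carrier (valuation_ring F v)" for a
    by (rule O.minus_equality) (use that in \<open>auto simp: carr add zero v_uminus l_neg\<close>)
  have pos_mult: "0 < v a + v b" if "0 < v a" "0 \<le> v b" for a b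
    using add_left_mono[OF that(2), of "v a"] that(1) by simp
  have sg: "subgroup (valuation_ideal F v) (add_monoid (valuation_ring F v))"
  proof (rule O.add.subgroupI)
    show "valuation_ideal F v \<subseteq> carrier (valuation_ring F v)"
      by (auto simp: carr valuation_ideal_def)
    show "valuation_ideal F v \<noteq> {}"
      using v_zero by (force simp: valuation_ideal_def zero_extended_def)
  next
    fix a assume a: "a \<in> valuation_ideal F v"
    then show "\<ominus>\<^bsub>valuation_ring F v\<^esub> a \<in> valuation_ideal F v"
      using uminus[of a] by (auto simp: carr valuation_ideal_def v_uminus)
    fix b assume "b \<in> valuation_ideal F v"
    then show "a \<oplus>\<^bsub>valuation_ring F v\<^esub> b \<in> valuation_ideal F v"
      using a less_le_trans[OF _ v_add_ge[of a b], of 0] by (simp add: add valuation_ideal_def)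
  qed
  have id: "ideal (valuation_ideal F v) (valuation_ring F v)"
    by (rule idealI[OF O.ring_axioms sg])
      (auto simp: carr mult valuation_ideal_def v_mult pos_mult add.commute)
  show ?thesis
  proof (rule primeidealI[OF id O.is_cring])
    show "carrier (valuation_ring F v) \<noteq> valuation_ideal F v"
      using v_one by (force simp: carr valuation_ideal_def)
  next
    fix a b
    assume "a \<in> carrier (valuation_ring F v)" "b \<in> carrier (valuation_ring F v)"
      "a \<otimes>\<^bsub>valuation_ring F v\<^esub> b \<in> valuation_ideal F v"
    then show "a \<in> valuation_ideal F v \<or> b \<in> valuation_ideal F v"
      by (auto simp: carr mult valuation_ideal_def v_mult order.order_iff_strict)
  qed
qed

lemma residue_field_domain: "domain (residue_field F v)"
  unfolding residue_field_def by (rule primeideal.quotient_is_domain[OF valuation_ideal_prime])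

lemma residue_hom: "ring_hom_ring (valuation_ring F v) (residue_field F v) (residue F v)"
  using ideal.rcos_ring_hom_ring[OF primeideal.axioms(1)[OF valuation_ideal_prime]]
  unfolding residue_field_def residue_def[abs_def] .

lemma residue_eq_zero_iff:
  assumes "a \<in> carrier F" "0 \<le> v a"
  shows "residue F v a = \<zero>\<^bsub>residue_field F v\<^esub> \<longleftrightarrow> 0 < v a"
proof -
  interpret I: primeideal "valuation_ideal F v" "valuation_ring F v" by (rule valuation_ideal_prime)
  have "a \<in> carrier (valuation_ring F v)" using assms unfolding valuation_ring_def by simp
  then have "valuation_ideal F v +>\<^bsub>valuation_ring F v\<^esub> a = valuation_ideal F v \<longleftrightarrow> a \<in> valuation_ideal F v"
    using I.rcos_const_imp_mem I.a_rcos_const by blast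
  then show ?thesis
    using assms unfolding residue_def residue_field_def FactRing_def valuation_ideal_def by simp
qed

end


section \<open>Algebraically closed subfields\<close>

locale alg_closed_subfield = field F for F (structure) +
  fixes K :: "'a set"
  assumes subfield: "subfield K F"
    and alg_closed: "algebraically_closed (F\<lparr>carrier := K\<rparr>)"
begin

lemma K_subring: "subring K F" and K_carrier: "a \<in> K \<Longrightarrow> a \<in> carrier F"
  using subfieldE(1,3)[OF subfield] by auto

lemma K_inv: "a \<in> K \<Longrightarrow> a \<noteq> \<zero> \<Longrightarrow> inv a \<in> K"
  using subfield_m_inv(1)[OF subfield] by blast

text \<open>The roots come from regarding \<open>K\<close> as a field in its own right. As the polynomial ring over \<open>K\<close>
  is the same whether it is formed in \<open>F\<close> or in the field \<open>K\<close> itself, the factor found in \<open>K\<close> can be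
  used in \<open>F\<close>, where the polynomial is evaluated at elements outside \<open>K\<close>.\<close>

lemma poly_has_linear_factor:
  assumes p: "p \<in> carrier (K[X])" and deg: "degree p \<noteq> 0"
  obtains c q where "c \<in> K" "q \<in> carrier (K[X])" "q \<noteq> []" "p = poly_mult [\<one>, \<ominus> c] q"
proof -
  interpret L: algebraically_closed "F\<lparr>carrier := K\<rparr>" by (rule alg_closed)
  have poly_ring: "K[X]\<^bsub>F\<lparr>carrier := K\<rparr>\<^esub> = K[X]"
    using univ_poly_consistent[OF K_subring] by simp
  have pL: "p \<in> carrier (poly_ring (F\<lparr>carrier := K\<rparr>))" using p by (simp add: poly_ring)
  have "L.roots p \<noteq> {#}" using L.roots_over_carrier[OF pL] deg unfolding L.splitted_def by auto
  then obtain c where c: "c \<in> K" and "[\<one>, \<ominus>\<^bsub>F\<lparr>carrier := K\<rparr>\<^esub> c] pdivides\<^bsub>F\<lparr>carrier := K\<rparr>\<^esub> p"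
    using L.not_empty_rootsE[OF pL] by force
  moreover have "\<ominus>\<^bsub>F\<lparr>carrier := K\<rparr>\<^esub> c = \<ominus> c"
    by (rule L.minus_equality) (use c K_carrier subringE(5)[OF K_subring] in \<open>auto simp: l_neg\<close>)
  ultimately obtain q where q: "q \<in> carrier (K[X])" "p = [\<one>, \<ominus> c] \<otimes>\<^bsub>K[X]\<^esub> q"
    using poly_ring unfolding pdivides_def factor_def by auto
  have pm: "p = poly_mult [\<one>, \<ominus> c] q" using q by (simp add: univ_poly_mult del: poly_mult.simps)
  moreover have "q \<noteq> []"
    using pm deg poly_mult_zero(2)[of "[\<one>, \<ominus> c]"] K_carrier[OF c] by (auto simp del: poly_mult.simps)
  ultimately show ?thesis using that c q(1) by blast
qed

lemma monic_linear_poly_closed: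
  assumes "c \<in> K"
  shows "[\<one>, \<ominus> c] \<in> carrier (K[X])"
  using assms subringE(3,5)[OF K_subring]
  by (auto simp: univ_poly_carrier[symmetric] polynomial_def)

lemma eval_linear_mult:
  assumes "c \<in> K" "q \<in> carrier (K[X])" "y \<in> carrier F"
  shows "eval (poly_mult [\<one>, \<ominus> c] q) y = (y \<ominus> c) \<otimes> eval q y"
proof -
  have "set q \<subseteq> carrier F"
    using assms(2) K_carrier by (auto simp: univ_poly_carrier[symmetric] polynomial_def)
  then have "eval (poly_mult [\<one>, \<ominus> c] q) y = eval [\<one>, \<ominus> c] y \<otimes> eval q y"
    by (intro eval_poly_mult) (use assms K_carrier in auto)
  moreover have "eval [\<one>, \<ominus> c] y = y \<ominus> c"
    using assms K_carrier by (simp add: minus_eq)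
  ultimately show ?thesis by simp
qed

text \<open>Only values of the polynomial matter later, so the factorization is recorded through evaluation. It
  holds at every point of \<open>F\<close>, not just of \<open>K\<close>: the residue argument needs it at a transcendental
  element, the approximation argument at elements of \<open>K\<close>.\<close>

lemma poly_eq_prod_linear_factors:
  assumes "p \<in> carrier (K[X])" "p \<noteq> []"
  shows "\<exists>cs. set cs \<subseteq> K \<and>
    (\<forall>y\<in>carrier F. eval p y = foldr (\<lambda>c z. (y \<ominus> c) \<otimes> z) cs (lead_coeff p))"
  using assms
proof (induction "length p" arbitrary: p rule: less_induct)
  case less
  show ?case
  proof (cases "degree p = 0")
    case True
    then obtain a where p: "p = [a]" using less.prems(2) by (cases p) auto
    then have "a \<in> carrier F"
      using less.prems(1) K_carrier by (auto simp: univ_poly_carrier[symmetric] polynomial_def)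
    then show ?thesis using p by (intro exI[of _ "[]"]) auto
  next
    case False
    obtain c q where c: "c \<in> K" and q: "q \<in> carrier (K[X])" "q \<noteq> []"
      and p: "p = poly_mult [\<one>, \<ominus> c] q"
      using poly_has_linear_factor[OF less.prems(1) False] .
    note lin = monic_linear_poly_closed[OF c]
    have deg: "degree p = degree [\<one>, \<ominus> c] + degree q" and lc: "lead_coeff p = lead_coeff [\<one>, \<ominus> c] \<otimes> lead_coeff q"
      unfolding p using poly_mult_degree_eq[OF K_subring] poly_mult_lead_coeff[OF K_subring] lin q
      by (auto simp: univ_poly_carrier simp del: poly_mult.simps)
    have "length q < length p" using deg q(2) by (cases q) auto
    from less.hyps[OF this q] obtain cs where cs: "set cs \<subseteq> K"
      and ev: "\<forall>y\<in>carrier F. eval q y = foldr (\<lambda>c z. (y \<ominus> c) \<otimes> z) cs (lead_coeff q)" by blast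
    have "lead_coeff q \<in> carrier F"
      using q K_carrier by (cases q) (auto simp: univ_poly_carrier[symmetric] polynomial_def)
    then have "lead_coeff p = lead_coeff q" using lc by simp
    then have "\<forall>y\<in>carrier F. eval p y = foldr (\<lambda>c z. (y \<ominus> c) \<otimes> z) (c # cs) (lead_coeff p)"
      using ev eval_linear_mult[OF c q(1)] unfolding p by (simp del: poly_mult.simps)
    moreover have "set (c # cs) \<subseteq> K" using cs c by simp
    ultimately show ?thesis by blast
  qed
qed

lemma nth_root_exists:
  assumes "a \<in> K" "n > 0"
  obtains b where "b \<in> K" "b [^] (n::nat) = a"
proof -
  \<comment> \<open>The coefficient list of \<open>X\<^sup>n - a\<close>, highest degree first; a root of it is an \<open>n\<close>-th root of \<open>a\<close>.\<close>
  define p where "p = \<one> # replicate (n - 1) \<zero> @ [\<ominus> a]"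
  have p: "p \<in> carrier (K[X])"
    using subringE(2,3)[OF K_subring] subringE(5)[OF K_subring assms(1)]
    by (simp add: p_def univ_poly_carrier[symmetric] polynomial_def subset_iff)
  obtain c q where c: "c \<in> K" and q: "q \<in> carrier (K[X])" "p = poly_mult [\<one>, \<ominus> c] q"
    by (rule poly_has_linear_factor[OF p]) (simp add: p_def)
  note cF = K_carrier[OF c] and aF = K_carrier[OF assms(1)]
  have "set q \<subseteq> carrier F"
    using q(1) K_carrier by (auto simp: univ_poly_carrier[symmetric] polynomial_def)
  then have "eval p c = \<zero>"
    using eval_linear_mult[OF c q(1) cF] q(2) cF eval_in_carrier[of q c]
    by (simp add: minus_eq r_neg del: poly_mult.simps)
  moreover have "eval p c = c [^] n \<ominus> a"
    using eval_replicate[of "[\<ominus> a]" c "n - 1"] cF aF assms(2) by (simp add: p_def minus_eq)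
  ultimately have "c [^] n = a" using cF aF by simp
  then show ?thesis using that c by blast
qed

end


section \<open>Valued fields over an algebraically closed subfield\<close>

locale valued_field_over_alg_closed = valued_field F v + alg_closed_subfield F K
  for F (structure) and v :: "'a \<Rightarrow> 'g::linordered_ab_group_add extended" and K
begin

text \<open>If \<open>n \<gamma> = v a\<close> and \<open>b\<^sup>n = a\<close>, then \<open>n \<gamma> = n (v b)\<close>, and multiplication by \<open>n\<close> is strictly monotone
  on an ordered group, so \<open>\<gamma> = v b\<close>.\<close>

lemma value_group_pure:
  assumes "torsion_modulo (value_group v K) \<gamma>"
  shows "\<gamma> \<in> value_group v K"
proof -
  obtain n :: nat and a where n: "n > 0" and a: "a \<in> K" "v a = Fin (\<Sum>i<n. \<gamma>)"
    using assms by (auto simp: torsion_modulo_def value_group_def)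
  obtain b where b: "b \<in> K" "b [^] n = a" using nth_root_exists[OF a(1) n] .
  have "a \<noteq> \<zero>" using a(2) v_zero by auto
  then have "b \<noteq> \<zero>" using b(2) n nat_pow_zero[of n] by auto
  then obtain \<beta> where be: "v b = Fin \<beta>" using v_finite[OF K_carrier[OF b(1)]] by blast
  have eq: "(\<Sum>i<n. \<beta>) = (\<Sum>i<n. \<gamma>)" using v_pow[OF K_carrier[OF b(1)] be, of n] b(2) a(2) by simp
  have "{..<n} \<noteq> {}" using n by auto
  then have lt: "(\<Sum>i<n. \<delta>) < (\<Sum>i<n. \<epsilon>)" if "\<delta> < \<epsilon>" for \<delta> \<epsilon> :: 'g
    by (intro sum_strict_mono) (use that in auto)
  have "\<beta> = \<gamma>"
    using lt[of \<beta> \<gamma>] lt[of \<gamma> \<beta>] eq by (cases rule: linorder_cases[of \<beta> \<gamma>]) simp_all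
  then show ?thesis using b(1) be unfolding value_group_def by blast
qed

lemma v_eval_eq_sum:
  assumes "p \<in> carrier (K[X])" "p \<noteq> []"
  obtains cs where "set cs \<subseteq> K"
    "\<And>y. y \<in> carrier F \<Longrightarrow> v (eval p y) = v (lead_coeff p) + (\<Sum>c\<leftarrow>cs. v (y \<ominus> c))"
proof -
  obtain cs where cs: "set cs \<subseteq> K"
    and ev: "\<forall>y\<in>carrier F. eval p y = foldr (\<lambda>c z. (y \<ominus> c) \<otimes> z) cs (lead_coeff p)"
    using poly_eq_prod_linear_factors[OF assms] by blast
  have "lead_coeff p \<in> carrier F"
    using assms K_carrier by (cases p) (auto simp: univ_poly_carrier[symmetric] polynomial_def)
  then show ?thesis
    using that[OF cs] ev cs K_carrier v_foldr_mult[of cs "\<lambda>c. _ \<ominus> c"] by (simp add: subset_iff)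
qed

text \<open>The hypothesis bounds the value at \<open>t\<close> of each linear factor from above by \<open>0\<close>, so the value of a
  polynomial at \<open>t\<close> is at most that of its leading coefficient. An algebraic
  relation over the residue field of \<open>K\<close>, lifted coefficient by coefficient to \<open>K\<close>, would violate this
  bound: its leading coefficient has value \<open>0\<close>, its value at \<open>t\<close> is positive.\<close>

lemma residue_transcendental_if_no_closer:
  assumes t: "t \<in> carrier F" "v t = 0" and far: "\<And>c. c \<in> K \<Longrightarrow> v (t \<ominus> c) \<le> 0"
  shows "residue_transcendental F K v t"
  unfolding residue_transcendental_def
proof (intro conjI t(2), rule ccontr)
  interpret R: domain "residue_field F v" by (rule residue_field_domain)
  interpret h: ring_hom_ring "valuation_ring F v" "residue_field F v" "residue F v"
    by (rule residue_hom)
  have O: "carrier (valuation_ring F v) = {a \<in> carrier F. 0 \<le> v a}"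
    by (simp add: valuation_ring_def)
  let ?OK = "{a \<in> K. 0 \<le> v a}"
  have OK: "?OK = K \<inter> {a \<in> carrier F. 0 \<le> v a}" using K_carrier by auto
  \<comment> \<open>The residue field of \<open>K\<close> is the image of the valuation ring of \<open>K\<close>, hence a subring.\<close>
  have "subring ?OK F" unfolding OK by (rule subring_inter[OF K_subring valuation_ring_subring])
  then have "ring (F\<lparr>carrier := ?OK\<rparr>)" by (rule subring_is_ring)
  then have "subring ?OK (valuation_ring F v)"
    using h.R.ring_incl_imp_subring[of ?OK] K_carrier by (auto simp: valuation_ring_def)
  then have sub: "subring (sub_residue_field F v K) (residue_field F v)"
    unfolding sub_residue_field_def by (rule h.img_is_subring)
  have tO: "t \<in> carrier (valuation_ring F v)" using t by (simp add: O)
  assume "\<not> R.transcendental (sub_residue_field F v K) (residue F v t)"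
  then obtain p' where p': "p' \<in> carrier (univ_poly (residue_field F v) (sub_residue_field F v K))"
    "p' \<noteq> []" "R.eval p' (residue F v t) = \<zero>\<^bsub>residue_field F v\<^esub>"
    using R.algebraicE[OF sub h.hom_closed[OF tO]] unfolding over_def by blast
  have set_p': "set p' \<subseteq> residue F v ` ?OK" and lead_p': "lead_coeff p' \<noteq> \<zero>\<^bsub>residue_field F v\<^esub>"
    using p'(1,2) by (auto simp: univ_poly_carrier[symmetric] polynomial_def sub_residue_field_def)
  have "p' \<in> lists (residue F v ` ?OK)" using set_p' by (simp add: lists_eq_set)
  then have "p' \<in> map (residue F v) ` lists ?OK" by (simp only: lists_image)
  then obtain p where p: "set p \<subseteq> ?OK" "p' = map (residue F v) p"
    unfolding lists_eq_set by blast
  have pne: "p \<noteq> []" using p(2) p'(2) by auto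
  have hd: "lead_coeff p \<in> K" "0 \<le> v (lead_coeff p)" using subsetD[OF p(1) hd_in_set[OF pne]] by simp_all
  \<comment> \<open>The lift has the same degree as the relation: its leading coefficient has nonzero residue.\<close>
  have vhd: "v (lead_coeff p) = 0"
  proof -
    have "residue F v (lead_coeff p) \<noteq> \<zero>\<^bsub>residue_field F v\<^esub>"
      using lead_p' pne unfolding p(2) by (simp add: hd_map)
    then have "\<not> 0 < v (lead_coeff p)"
      using residue_eq_zero_iff[OF K_carrier[OF hd(1)] hd(2)] by simp
    then show ?thesis using hd(2) by simp
  qed
  then have "lead_coeff p \<noteq> \<zero>" using v_zero by (metis extended.distinct(1) zero_extended_def)
  then have pK: "p \<in> carrier (K[X])"
    using p(1) by (auto simp: univ_poly_carrier[symmetric] polynomial_def)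
  have pO: "set p \<subseteq> carrier (valuation_ring F v)" using p(1) K_carrier by (auto simp: O)
  have evO: "h.R.eval p t = eval p t"
    unfolding valuation_ring_def by (simp add: eval_consistent[OF valuation_ring_subring])
  have "eval p t \<in> carrier (valuation_ring F v)"
    using h.R.eval_in_carrier[OF pO tO] by (simp add: evO)
  moreover have "residue F v (eval p t) = \<zero>\<^bsub>residue_field F v\<^esub>"
    using h.eval_hom'[OF tO pO] p'(3) p(2) by (simp add: evO)
  ultimately have pos: "0 < v (eval p t)" using residue_eq_zero_iff[of "eval p t"] by (simp add: O)
  obtain cs where cs: "set cs \<subseteq> K"
    and ev: "v (eval p t) = v (lead_coeff p) + (\<Sum>c\<leftarrow>cs. v (t \<ominus> c))"
    by (rule v_eval_eq_sum[OF pK pne]) (use t(1) in blast)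
  have "(\<Sum>c\<leftarrow>cs. v (t \<ominus> c)) \<le> 0"
    using cs
  proof (induction cs)
    case (Cons c cs)
    then show ?case using add_mono[OF far[of c] Cons.IH] by simp
  qed simp
  then show False using pos unfolding ev vhd by simp
qed

text \<open>Absence of a best approximation gives, for each \<open>c \<in> K\<close>, a nonempty ball around \<open>x\<close> all of whose
  elements are strictly closer to \<open>x\<close> than \<open>c\<close> is. That ball avoids \<open>c\<close>, which empties the
  intersection; and if \<open>c\<close> runs through the roots of a polynomial, the smallest of the finitely many
  balls is one on which the value of the polynomial is constant.\<close>

lemma transcendental_immediate_if_no_closest:
  assumes x: "x \<in> carrier F"
    and val: "\<And>c. c \<in> K \<Longrightarrow> \<exists>\<gamma>\<in>value_group v K. v (x \<ominus> c) = Fin \<gamma>"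
    and closer: "\<And>c. c \<in> K \<Longrightarrow> \<exists>c'\<in>K. v (x \<ominus> c) < v (x \<ominus> c')"
  shows "transcendental_immediate_appr F K v x"
proof -
  have supp: "\<exists>\<gamma>\<in>appr_support F K v x. v (x \<ominus> c) < Fin \<gamma>" if c: "c \<in> K" for c
  proof -
    obtain c' where c': "c' \<in> K" "v (x \<ominus> c) < v (x \<ominus> c')" using closer[OF c] by blast
    obtain \<gamma> where g: "\<gamma> \<in> value_group v K" "v (x \<ominus> c') = Fin \<gamma>" using val[OF c'(1)] by blast
    then have "c' \<in> appr F K v x \<gamma>" using c'(1) by (simp add: appr_def)
    then show ?thesis using g c'(2) unfolding appr_support_def by auto
  qed
  have zK: "\<zero> \<in> K" using subringE(2)[OF K_subring] .
  have "\<Inter>(appr_balls F K v x) = {}"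
  proof (rule ccontr)
    assume "\<Inter>(appr_balls F K v x) \<noteq> {}"
    then obtain c where c: "\<And>B. B \<in> appr_balls F K v x \<Longrightarrow> c \<in> B" by blast
    have ball: "c \<in> appr F K v x \<gamma>" if "\<gamma> \<in> appr_support F K v x" for \<gamma>
      using that by (intro c) (auto simp: appr_balls_def appr_support_def)
    then have "c \<in> K" using supp[OF zK] by (auto simp: appr_def)
    then obtain \<gamma> where "\<gamma> \<in> appr_support F K v x" "v (x \<ominus> c) < Fin \<gamma>" using supp by blast
    then show False using ball[of \<gamma>] by (auto simp: appr_def)
  qed
  then have "immediate_appr F K v x" using supp[OF zK] by (auto simp: immediate_appr_def)
  moreover have "\<exists>\<delta>\<in>appr_support F K v x.
      \<forall>c\<in>appr F K v x \<delta>. \<forall>c'\<in>appr F K v x \<delta>. v (eval p c) = v (eval p c')"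
    if p: "p \<in> carrier (K[X])" for p
  proof (cases "p = []")
    case True
    then show ?thesis using supp[OF zK] by auto
  next
    case False
    obtain cs where cs: "set cs \<subseteq> K"
      and ev: "\<And>y. y \<in> carrier F \<Longrightarrow> v (eval p y) = v (lead_coeff p) + (\<Sum>c\<leftarrow>cs. v (y \<ominus> c))"
      using v_eval_eq_sum[OF p False] by blast
    \<comment> \<open>A ball around \<open>x\<close> whose elements are closer to \<open>x\<close> than all the roots.\<close>
    have "\<exists>\<delta>\<in>appr_support F K v x. \<forall>c\<in>set cs. v (x \<ominus> c) < Fin \<delta>"
      using cs
    proof (induction cs)
      case Nil
      then show ?case using supp[OF zK] by auto
    next
      case (Cons c cs)
      obtain \<delta> \<delta>' where "\<delta> \<in> appr_support F K v x" "\<forall>c\<in>set cs. v (x \<ominus> c) < Fin \<delta>"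
        "\<delta>' \<in> appr_support F K v x" "v (x \<ominus> c) < Fin \<delta>'"
        using Cons supp[of c] by auto
      then show ?case
        by (intro bexI[of _ "max \<delta> \<delta>'"]) (auto simp: max_def intro: less_le_trans)
    qed
    then obtain \<delta> where d: "\<delta> \<in> appr_support F K v x" "\<forall>c\<in>set cs. v (x \<ominus> c) < Fin \<delta>" by blast
    have "v (eval p y) = v (lead_coeff p) + (\<Sum>c\<leftarrow>cs. v (x \<ominus> c))" if y: "y \<in> appr F K v x \<delta>" for y
    proof -
      have yK: "y \<in> K" "Fin \<delta> \<le> v (x \<ominus> y)" using y by (auto simp: appr_def)
      have "v (y \<ominus> c) = v (x \<ominus> c)" if c: "c \<in> set cs" for c
      proof -
        have cF: "c \<in> carrier F" using c cs K_carrier by auto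
        have "v (x \<ominus> c) < v (x \<ominus> y)" using d(2) c yK(2) by (auto intro: less_le_trans)
        then have "v ((x \<ominus> c) \<ominus> (x \<ominus> y)) = v (x \<ominus> c)"
          using v_diff_eq_min x cF K_carrier[OF yK(1)] by simp
        moreover have "(x \<ominus> c) \<ominus> (x \<ominus> y) = y \<ominus> c"
          using x cF K_carrier[OF yK(1)] by algebra
        ultimately show ?thesis by simp
      qed
      then have "(\<Sum>c\<leftarrow>cs. v (y \<ominus> c)) = (\<Sum>c\<leftarrow>cs. v (x \<ominus> c))" by (intro arg_cong[of _ _ sum_list]) simp
      then show ?thesis using ev[OF K_carrier[OF yK(1)]] by simp
    qed
    then show ?thesis using d(1) by (intro bexI[of _ \<delta>]) simp_all
  qed
  ultimately show ?thesis unfolding transcendental_immediate_appr_def by blast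
qed

theorem pure_if_not_in_subfield:
  assumes x: "x \<in> carrier F" "x \<notin> K"
  shows "pure_extension F K v x"
proof -
  have fin: "\<exists>\<gamma>. v (x \<ominus> c) = Fin \<gamma>" if c: "c \<in> K" for c
    using v_finite[of "x \<ominus> c"] x c K_carrier[OF c] by (metis minus_closed r_right_minus_eq)
  consider (new_value) b \<gamma> where "b \<in> K" "v (x \<ominus> b) = Fin \<gamma>" "\<gamma> \<notin> value_group v K"
    | (closest) b \<gamma> where "b \<in> K" "v (x \<ominus> b) = Fin \<gamma>" "\<gamma> \<in> value_group v K"
        "\<And>c. c \<in> K \<Longrightarrow> v (x \<ominus> c) \<le> v (x \<ominus> b)"
    | (no_closest) "\<And>c. c \<in> K \<Longrightarrow> \<exists>\<gamma>\<in>value_group v K. v (x \<ominus> c) = Fin \<gamma>"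
        "\<And>c. c \<in> K \<Longrightarrow> \<exists>c'\<in>K. v (x \<ominus> c) < v (x \<ominus> c')"
    using fin by (metis not_le)
  then show ?thesis
  proof cases
    case new_value
    then have "value_transcendental K v (\<one> \<otimes> (x \<ominus> b))"
      using value_group_pure x K_carrier by (auto simp: value_transcendental_def)
    then show ?thesis
      using new_value(1) subringE(3)[OF K_subring]
      unfolding pure_extension_def valuation_transcendental_def by blast
  next
    case closest
    obtain a where a: "a \<in> K" "v a = Fin \<gamma>" using closest(3) by (auto simp: value_group_def)
    have a0: "a \<noteq> \<zero>" using a(2) v_zero by auto
    define d where "d = inv a"
    have aF: "a \<in> carrier F" and bF: "b \<in> carrier F" using a closest(1) K_carrier by auto
    have d: "d \<in> K" unfolding d_def using K_inv a(1) a0 .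
    have dF: "d \<in> carrier F" using K_carrier[OF d] .
    have da: "d \<otimes> a = \<one>" unfolding d_def using field_Units aF a0 by simp
    have vd: "v d = Fin (- \<gamma>)"
    proof -
      have "d \<noteq> \<zero>" using da aF by auto
      then obtain \<epsilon> where e: "v d = Fin \<epsilon>" using v_finite[OF dF] by blast
      have "v d + v a = 0" using v_mult[OF dF aF] da v_one by simp
      then show ?thesis using e a(2) by (simp add: zero_extended_def eq_neg_iff_add_eq_0)
    qed
    have "residue_transcendental F K v (d \<otimes> (x \<ominus> b))"
    proof (rule residue_transcendental_if_no_closer)
      show "d \<otimes> (x \<ominus> b) \<in> carrier F" using dF x bF by simp
      show "v (d \<otimes> (x \<ominus> b)) = 0"
        using v_mult[of d "x \<ominus> b"] dF x bF vd closest(2) by (simp add: zero_extended_def)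
    next
      fix c assume c: "c \<in> K"
      have cF: "c \<in> carrier F" using K_carrier[OF c] .
      \<comment> \<open>Approximating \<open>d (x - b)\<close> by \<open>c\<close> amounts to approximating \<open>x\<close> by \<open>b + a c\<close>, as \<open>a\<close> inverts \<open>d\<close>.\<close>
      have ac: "b \<oplus> a \<otimes> c \<in> K"
        using subringE(6,7)[OF K_subring] c a(1) closest(1) by simp
      have "d \<otimes> (x \<ominus> (b \<oplus> a \<otimes> c)) = d \<otimes> (x \<ominus> b) \<ominus> (d \<otimes> a) \<otimes> c"
        using dF x(1) aF bF cF by algebra
      then have "d \<otimes> (x \<ominus> b) \<ominus> c = d \<otimes> (x \<ominus> (b \<oplus> a \<otimes> c))" using da cF by simp
      then have "v (d \<otimes> (x \<ominus> b) \<ominus> c) = v d + v (x \<ominus> (b \<oplus> a \<otimes> c))"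
        using v_mult dF x(1) K_carrier[OF ac] by simp
      also have "\<dots> \<le> v d + v (x \<ominus> b)" using closest(4)[OF ac] by (rule add_left_mono)
      also have "\<dots> = 0" using vd closest(2) by (simp add: zero_extended_def)
      finally show "v (d \<otimes> (x \<ominus> b) \<ominus> c) \<le> 0" .
    qed
    then show ?thesis
      using closest(1) d unfolding pure_extension_def valuation_transcendental_def by blast
  next
    case no_closest
    then show ?thesis
      using transcendental_immediate_if_no_closest[OF x(1)] unfolding pure_extension_def by blast
  qed
qed

end

theorem proposition5p2:
  fixes F :: "('a, 'b) ring_scheme"
    and K :: "'a set" and x :: 'a
    and v\<^sub>0 v :: "'a \<Rightarrow> 'g::linordered_ab_group_add extended"
  assumes "field F"
    and "subfield K F"
    and "algebraically_closed (F\<lparr>carrier := K\<rparr>)"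
    and "krull_valuation (F\<lparr>carrier := K\<rparr>) v\<^sub>0"
    and "x \<in> carrier F"
    and "ring.transcendental F K x"
    and "carrier F = generate_field F (insert x K)"
    and "krull_valuation F v"
    and "\<And>a. a \<in> K \<Longrightarrow> v a = v\<^sub>0 a"
  shows "pure_extension F K v x"
proof -
  interpret valued_field_over_alg_closed F v K
    using assms(1,2,3,8)
    by (simp add: valued_field_over_alg_closed_def valued_field_def valued_field_axioms_def
        alg_closed_subfield_def alg_closed_subfield_axioms_def)
  have "x \<notin> K"
    using algebraic_self[OF K_subring] assms(6) unfolding over_def by blast
  then show ?thesis by (rule pure_if_not_in_subfield[OF assms(5)])
qed

end
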